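(* Let $A\in\mathbb{R}^{m\times m}$, $B\in\mathbb{R}^{m\times 1}$, $C\in\mathbb{R}^{1\times m}$ with $CB\neq 0$, and let $G(z)=C(zI-A)^{-1}B$. Let $\delta\in(0,2]$ and $M\in\mathbb{N}\cup\{\infty\}$, and put $$U_M=\{k\delta : k\in\mathbb{Z},\ |k|\le M\},\qquad K_M(\theta)=\min\Big\{\arg\min_{u\in U_M}|\theta-u|\Big\}\quad(\theta\in\mathbb{R}).$$ Let $\widehat\Psi\in\mathcal{Y}_{U_M}$ be the ADC that maps an input $r\in\ell_+([-1,1])$ to the output $u$ determined recursively, for $n\in\mathbb{Z}_+$, by $$x_{\widehat\Psi}[0]=0,\qquad u[n]=K_M\big((CB)^{-1}CA\,x_{\widehat\Psi}[n]+r[n]\big),\qquad x_{\widehat\Psi}[n+1]=Ax_{\widehat\Psi}[n]+Br[n]-Bu[n],$$ and let $q_{\widehat\Psi}[n]=Cx_{\widehat\Psi}[n]$. Let $$q_{\widehat\Psi}[n+1]=\sum_{i=0}^{k}a_i\,q_{\widehat\Psi}[n-i]+\sum_{j=0}^{k}b_j\,(r[n-j]-u[n-j])$$ be the difference equation equivalent to the state-space system $x_{\widehat\Psi}[0]=0$, $x_{\widehat\Psi}[n+1]=Ax_{\widehat\Psi}[n]+Br[n]-Bu[n]$, $q_{\widehat\Psi}[n]=Cx_{\widehat\Psi}[n]$ (from $r-u$ to $q_{\widehat\Psi}$), and let $\{c_l\}_{l=0}^\infty$ be defined by $$F(z)=\frac{1}{\sum_{j=0}^{k}b_jz^{-j}}=\sum_{l=0}^{\infty}c_lz^{-l}\qquad\text{for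 } |z|>R_0,$$ where $R_0$ is the maximal absolute value of the poles of $F$. Let $$\beta=\left[\,|CB|\,\frac{\delta}{2}\Big(\sum_{i=0}^{k}|a_i|+1\Big)+\sum_{j=0}^{k}|b_j|\right]\sum_{l=0}^{\infty}|c_l| .$$ Assume that $M\delta>1$ and $M\delta>\beta-\delta$. Let $f:[0,\infty)\to[0,\infty)$ be a monotonically nondecreasing function and let $\phi(q)=f(|q|)$ for $q\in\mathbb{R}$. Then $\widehat\Psi$ is an optimal ADC in the sense that $$\mathcal{J}_{G,\phi}(\Psi)\ \ge\ \mathcal{J}_{G,\phi}(\widehat\Psi)=\phi\big(|CB|\,\delta/2\big)\qquad\text{for all }\Psi\in\mathcal{Y}_{U_M}.$$
   Context: $\mathbb{Z}_+=\{0,1,2,\dots\}$. For a set $P$, $\ell_+(P)$ denotes the set of all sequences $x:\mathbb{Z}_+\to P$. **ADCs.** For $U\subset\mathbb{R}$, an analog to digital converter (ADC) with output set $U$ is a causal discrete-time system $\Psi$ mapping each $r\in\ell_+([-1,1])$ to $u=\Psi(r)\in\ell_+(U)$, given by a sequence of (arbitrary) functions $\Upsilon_n:[-1,1]^{n+1}\to U$ via $u[n]=\Upsilon_n(r[n],r[n-1],\dots,r[0])$, $n\in\mathbb{Z}_+$. The class of all such ADCs is $\mathcal{Y}_U$. (For $M=\infty$, $U_\infty=\delta\mathbb{Z}$ and $\mathcal{Y}_{U_\infty}$ is defined by the same formula.) **Performance.** For a real scalar sequence $w$, let $q$ be the output of the strictly causal single-input single-output LTI system $L_G$ with transfer function $G(z)=C(zI-A)^{-1}B$: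 $$x[0]=0,\qquad x[n+1]=Ax[n]+Bw[n],\qquad q[n]=Cx[n].$$ The Asymptotic Weighted Average Intensity of $w$ is $$\eta_{G,\phi}(w)=\limsup_{N\to\infty}\frac1N\sum_{n=0}^{N-1}\phi(q[n])\in[0,\infty].$$ The performance measure of an ADC $\Psi$ is $$\mathcal{J}_{G,\phi}(\Psi)=\sup_{r\in\ell_+([-1,1])}\eta_{G,\phi}\big(r-\Psi(r)\big).$$ **Conventions.** $\arg\min_{u\in U_M}|\theta-u|$ is the set of all minimizers, so $K_M(\theta)$ is the smallest element of $U_M$ nearest to $\theta$. The difference equation is equivalent to the state-space system in the input-output sense: signals with negative time index are taken to be $0$, and the real coefficients satisfy $G(z)=\big(\sum_{j=0}^k b_jz^{-j-1}\big)\big/\big(1-\sum_{i=0}^k a_iz^{-i-1}\big)$; in particular $b_0=CB\neq0$, so $\{c_l\}$ is well defined as the unit sample response of the causal LTI system with transfer function $F$. The sum $\sum_l|c_l|$, and hence $\beta$, may be $+\infty$; inequalities are understood in the extended reals, with $\infty\cdot\delta=\infty$. *)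

theory Defs
  imports "HOL-Complex_Analysis.Complex_Analysis"
begin

definition ell_plus :: "'a set \<Rightarrow> (nat \<Rightarrow> 'a) set" where
  "ell_plus P = {x. range x \<subseteq> P}"

text \<open>An ADC is represented by a function on all real sequences; only its values on inputs
  in \<open>[-1,1]\<close> are constrained, and only those are used below.  The argument of \<open>\<Upsilon> n\<close> is the
  list \<open>[r n, r (n - 1), \<dots>, r 0]\<close> of length \<open>n + 1\<close>.\<close>

definition adc_class :: "real set \<Rightarrow> ((nat \<Rightarrow> real) \<Rightarrow> (nat \<Rightarrow> real)) set" where
  "adc_class U = {\<Psi>. \<exists>\<Upsilon> :: nat \<Rightarrow> real list \<Rightarrow> real.
     (\<forall>n v. length v = n + 1 \<and> set v \<subseteq> {-1..1} \<longrightarrow> \<Upsilon> n v \<in> U) \<and>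
     (\<forall>r\<in>ell_plus {-1..1}. \<forall>n. \<Psi> r n = \<Upsilon> n (map r (rev [0..<n + 1])))}"

text \<open>The matrix \<open>B\<close> (one column) and the matrix \<open>C\<close> (one row) are both vectors here, so that
  \<open>C x\<close> and \<open>C B\<close> are inner products.\<close>

primrec lti_state :: "real^'m^'m \<Rightarrow> real^'m \<Rightarrow> (nat \<Rightarrow> real) \<Rightarrow> nat \<Rightarrow> real^'m" where
  "lti_state A B w 0 = 0"
| "lti_state A B w (Suc n) = A *v lti_state A B w n + w n *\<^sub>R B"

definition lti_output ::
  "real^'m^'m \<Rightarrow> real^'m \<Rightarrow> real^'m \<Rightarrow> (nat \<Rightarrow> real) \<Rightarrow> nat \<Rightarrow> real" where
  "lti_output A B C w n = C \<bullet> lti_state A B w n"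

text \<open>The transfer function \<open>C (z I - A)\<^sup>-\<^sup>1 B\<close>, meaningful where \<open>z I - A\<close> is invertible.\<close>

definition resolvent_matrix :: "real^'m^'m \<Rightarrow> complex \<Rightarrow> complex^'m^'m" where
  "resolvent_matrix A z = mat z - map_matrix complex_of_real A"

definition transfer_fun :: "real^'m^'m \<Rightarrow> real^'m \<Rightarrow> real^'m \<Rightarrow> complex \<Rightarrow> complex" where
  "transfer_fun A B C z =
     (\<Sum>i\<in>UNIV. of_real (C $ i) *
        (matrix_inv (resolvent_matrix A z) *v (\<chi> j. of_real (B $ j))) $ i)"

definition awai ::
  "real^'m^'m \<Rightarrow> real^'m \<Rightarrow> real^'m \<Rightarrow> (real \<Rightarrow> real) \<Rightarrow> (nat \<Rightarrow> real) \<Rightarrow> ereal" where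
  "awai A B C \<phi> w = limsup (\<lambda>N. ereal (1 / real N * (\<Sum>n<N. \<phi> (lti_output A B C w n))))"

definition adc_performance ::
  "real^'m^'m \<Rightarrow> real^'m \<Rightarrow> real^'m \<Rightarrow> (real \<Rightarrow> real) \<Rightarrow>
    ((nat \<Rightarrow> real) \<Rightarrow> (nat \<Rightarrow> real)) \<Rightarrow> ereal" where
  "adc_performance A B C \<phi> \<Psi> = (SUP r\<in>ell_plus {-1..1}. awai A B C \<phi> (\<lambda>n. r n - \<Psi> r n))"

definition levels :: "real \<Rightarrow> enat \<Rightarrow> real set" where
  "levels \<delta> M = {of_int k * \<delta> | k :: int. enat (nat \<bar>k\<bar>) \<le> M}"

definition quantizer :: "real \<Rightarrow> enat \<Rightarrow> real \<Rightarrow> real" where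
  "quantizer \<delta> M \<theta> = Min {u. is_arg_min (\<lambda>u. \<bar>\<theta> - u\<bar>) (\<lambda>u. u \<in> levels \<delta> M) u}"

definition opt_control ::
  "real^'m^'m \<Rightarrow> real^'m \<Rightarrow> real^'m \<Rightarrow> real \<Rightarrow> enat \<Rightarrow> real^'m \<Rightarrow> real \<Rightarrow> real" where
  "opt_control A B C \<delta> M x \<rho> = quantizer \<delta> M (inverse (C \<bullet> B) * (C \<bullet> (A *v x)) + \<rho>)"

primrec opt_state ::
  "real^'m^'m \<Rightarrow> real^'m \<Rightarrow> real^'m \<Rightarrow> real \<Rightarrow> enat \<Rightarrow> (nat \<Rightarrow> real) \<Rightarrow> nat \<Rightarrow> real^'m" where
  "opt_state A B C \<delta> M r 0 = 0"
| "opt_state A B C \<delta> M r (Suc n) =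
     A *v opt_state A B C \<delta> M r n + r n *\<^sub>R B
       - opt_control A B C \<delta> M (opt_state A B C \<delta> M r n) (r n) *\<^sub>R B"

definition opt_adc ::
  "real^'m^'m \<Rightarrow> real^'m \<Rightarrow> real^'m \<Rightarrow> real \<Rightarrow> enat \<Rightarrow> (nat \<Rightarrow> real) \<Rightarrow> (nat \<Rightarrow> real)" where
  "opt_adc A B C \<delta> M r n = opt_control A B C \<delta> M (opt_state A B C \<delta> M r n) (r n)"

text \<open>\<open>delayed s n i\<close> is \<open>s[n - i]\<close>, with signals taken to be 0 at negative times.\<close>

definition delayed :: "(nat \<Rightarrow> real) \<Rightarrow> nat \<Rightarrow> nat \<Rightarrow> real" where
  "delayed s n i = (if i \<le> n then s (n - i) else 0)"

text \<open>The second conjunct is equality of rational functions: both sides are compared wherever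
  both are defined.  It is equivalent to the first conjunct, which says the same in the
  time domain.\<close>

definition equivalent_difference_equation ::
  "real^'m^'m \<Rightarrow> real^'m \<Rightarrow> real^'m \<Rightarrow> nat \<Rightarrow> (nat \<Rightarrow> real) \<Rightarrow> (nat \<Rightarrow> real) \<Rightarrow> bool" where
  "equivalent_difference_equation A B C k a b \<longleftrightarrow>
     (\<forall>w q. q = lti_output A B C w \<longleftrightarrow>
        q 0 = 0 \<and>
        (\<forall>n. q (Suc n) = (\<Sum>i\<le>k. a i * delayed q n i) + (\<Sum>j\<le>k. b j * delayed w n j))) \<and>
     (\<forall>z. z \<noteq> 0 \<and> invertible (resolvent_matrix A z) \<and>
        1 - (\<Sum>i\<le>k. of_real (a i) / z ^ (i + 1)) \<noteq> 0 \<longrightarrow>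
        transfer_fun A B C z =
          (\<Sum>j\<le>k. of_real (b j) / z ^ (j + 1)) / (1 - (\<Sum>i\<le>k. of_real (a i) / z ^ (i + 1))))"

definition inverse_numerator :: "nat \<Rightarrow> (nat \<Rightarrow> real) \<Rightarrow> complex \<Rightarrow> complex" where
  "inverse_numerator k b z = 1 / (\<Sum>j\<le>k. of_real (b j) / z ^ j)"

text \<open>The maximum is 0 if there are no poles.  For the rational functions considered here the
  set of poles is finite.\<close>

definition max_pole_modulus :: "(complex \<Rightarrow> complex) \<Rightarrow> real" where
  "max_pole_modulus F = Max (insert 0 {norm p | p. is_pole F p})"

definition overload_bound ::
  "real^'m \<Rightarrow> real^'m \<Rightarrow> real \<Rightarrow> nat \<Rightarrow> (nat \<Rightarrow> real) \<Rightarrow> (nat \<Rightarrow> real) \<Rightarrow> (nat \<Rightarrow> real) \<Rightarrow> ereal" where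
  "overload_bound B C \<delta> k a b c =
     ereal (\<bar>C \<bullet> B\<bar> * (\<delta> / 2) * ((\<Sum>i\<le>k. \<bar>a i\<bar>) + 1) + (\<Sum>j\<le>k. \<bar>b j\<bar>)) *
     (\<Sum>l. ereal \<bar>c l\<bar>)"

end

theory Submission
  imports Defs
begin

text \<open>Write the output one step ahead as \<open>q (n + 1) = (C \<bullet> B) (\<theta> n - u n)\<close>, where
  \<open>\<theta> n = (C \<bullet> B)\<^sup>-\<^sup>1 C A x n + r n\<close> combines the state reached so far with the current input.
  The current choice \<open>u n\<close> affects the next output only through the distance from \<open>\<theta> n\<close> to
  the chosen level, and the value \<open>\<bar>C \<bullet> B\<bar> \<delta> / 2\<close> is both the least bound that can be
  guaranteed and attainable, at every instant after the first.

  Nothing smaller can be guaranteed: knowing the past, an adversary can choose \<open>r n\<close> in an interval of length 2,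
  which is at least \<open>\<delta>\<close>, so as to put \<open>\<theta> n\<close> halfway between two grid points. Causality makes
  this a legitimate recursive definition of one input signal against a given converter
  (lemma \<open>adversarial_input\<close>), and monotonicity of \<open>f\<close> turns it into a lower bound on the
  average intensity.

  The bound is attained: the nearest-level rule achieves \<open>\<bar>q (n + 1)\<bar> \<le> \<bar>C \<bullet> B\<bar> \<delta> / 2\<close> as long as the
  quantizer does not overload, that is, as long as some level lies within \<open>\<delta> / 2\<close> of \<open>\<theta> n\<close>.
  To exclude overload, read the difference equation backwards. If all outputs are small, then
  the numerator coefficients convolved with \<open>u\<close> are bounded, and inverting the numerator
  yields \<open>\<bar>u n\<bar> \<le> \<beta>\<close> (lemma \<open>control_bound\<close>). This is applied inductively to the hypothetical
  control that rounds \<open>\<theta> n\<close> to the unbounded grid: it keeps the next output small by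
  construction, so it is at most \<open>\<beta> < (M + 1) \<delta>\<close>, hence an available level
  (lemma \<open>opt_output_bound\<close>).

  That \<open>c\<close> is the convolution inverse of \<open>b\<close> is an identity of formal power series,
  obtained from the convergent expansion of \<open>F\<close> near infinity by substituting \<open>w = 1 / z\<close>
  (lemma \<open>inverse_numerator_fps\<close>).\<close>

section \<open>The quantizer\<close>

lemma zero_in_levels: "0 \<in> levels \<delta> M"
  unfolding levels_def by (rule CollectI, rule exI[of _ 0]) (simp add: zero_enat_def[symmetric])

lemma finite_levels_bounded:
  assumes "\<delta> > 0"
  shows "finite {u \<in> levels \<delta> M. \<bar>u\<bar> \<le> h}"
proof (rule finite_subset)
  show "{u \<in> levels \<delta> M. \<bar>u\<bar> \<le> h} \<subseteq> (\<lambda>k. of_int k * \<delta>) ` {-\<lceil>h / \<delta>\<rceil>..\<lceil>h / \<delta>\<rceil>}"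
  proof
    fix u assume "u \<in> {u \<in> levels \<delta> M. \<bar>u\<bar> \<le> h}"
    then obtain k :: int where k: "u = of_int k * \<delta>" "\<bar>of_int k * \<delta>\<bar> \<le> h"
      by (auto simp: levels_def)
    have "\<bar>of_int k :: real\<bar> \<le> h / \<delta>"
      using k(2) assms by (simp add: abs_mult field_simps)
    then have "\<bar>k\<bar> \<le> \<lceil>h / \<delta>\<rceil>" by linarith
    then have "k \<in> {-\<lceil>h / \<delta>\<rceil>..\<lceil>h / \<delta>\<rceil>}" by simp linarith
    then show "u \<in> (\<lambda>k. of_int k * \<delta>) ` {-\<lceil>h / \<delta>\<rceil>..\<lceil>h / \<delta>\<rceil>}"
      unfolding k(1) by (rule imageI)
  qed
qed simp

text \<open>Although there may be infinitely many levels, only those at distance at most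
  \<open>\<bar>\<theta>\<bar>\<close>, the distance to the level 0, compete for the minimum, and they are finite in
  number. Hence the minimum and the choice of the smallest minimizer make sense.\<close>

lemma quantizer_arg_min:
  assumes "\<delta> > 0"
  shows "is_arg_min (\<lambda>u. \<bar>\<theta> - u\<bar>) (\<lambda>u. u \<in> levels \<delta> M) (quantizer \<delta> M \<theta>)"
proof -
  let ?D = "{u. is_arg_min (\<lambda>u. \<bar>\<theta> - u\<bar>) (\<lambda>u. u \<in> levels \<delta> M) u}"
  let ?L = "{u \<in> levels \<delta> M. \<bar>u\<bar> \<le> 2 * \<bar>\<theta>\<bar>}"
  have fin: "finite ?L" using assms by (rule finite_levels_bounded)
  have "0 \<in> ?L" using zero_in_levels by simp
  then obtain u where u: "u \<in> ?L" "\<And>v. v \<in> ?L \<Longrightarrow> \<bar>\<theta> - u\<bar> \<le> \<bar>\<theta> - v\<bar>"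
    using ex_is_arg_min_if_finite[OF fin, of "\<lambda>u. \<bar>\<theta> - u\<bar>"]
    by (fastforce simp: is_arg_min_linorder)
  have "\<bar>\<theta> - u\<bar> \<le> \<bar>\<theta> - v\<bar>" if "v \<in> levels \<delta> M" for v
  proof (cases "v \<in> ?L")
    case False
    then have "\<bar>v\<bar> > 2 * \<bar>\<theta>\<bar>" using that by auto
    moreover have "\<bar>\<theta> - u\<bar> \<le> \<bar>\<theta>\<bar>" using u(2)[OF \<open>0 \<in> ?L\<close>] by simp
    ultimately show ?thesis by linarith
  qed (rule u(2))
  then have "u \<in> ?D" using u(1) by (auto simp: is_arg_min_linorder)
  moreover have "?D \<subseteq> ?L"
  proof
    fix v assume "v \<in> ?D"
    then have v: "v \<in> levels \<delta> M" "\<bar>\<theta> - v\<bar> \<le> \<bar>\<theta> - 0\<bar>"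
      using zero_in_levels unfolding is_arg_min_linorder by blast+
    from v(2) have "\<bar>v\<bar> \<le> 2 * \<bar>\<theta>\<bar>" by linarith
    with v(1) show "v \<in> ?L" by simp
  qed
  then have "finite ?D" using fin by (rule finite_subset)
  ultimately have "Min ?D \<in> ?D" by (intro Min_in) auto
  then show ?thesis by (simp add: quantizer_def)
qed

lemma quantizer_in_levels: "\<delta> > 0 \<Longrightarrow> quantizer \<delta> M \<theta> \<in> levels \<delta> M"
  using quantizer_arg_min by (auto simp: is_arg_min_linorder)

lemma quantizer_nearest:
  "\<delta> > 0 \<Longrightarrow> u \<in> levels \<delta> M \<Longrightarrow> \<bar>\<theta> - quantizer \<delta> M \<theta>\<bar> \<le> \<bar>\<theta> - u\<bar>"
  using quantizer_arg_min[of \<delta> \<theta> M] by (auto simp: is_arg_min_linorder)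

lemma round_to_grid:
  assumes "\<delta> > 0"
  shows "\<bar>\<theta> - of_int (round (\<theta> / \<delta>)) * \<delta>\<bar> \<le> \<delta> / 2"
proof -
  have "\<theta> - of_int (round (\<theta> / \<delta>)) * \<delta> = \<delta> * (\<theta> / \<delta> - of_int (round (\<theta> / \<delta>)))"
    using assms by (simp add: field_simps)
  then have "\<bar>\<theta> - of_int (round (\<theta> / \<delta>)) * \<delta>\<bar> = \<delta> * \<bar>of_int (round (\<theta> / \<delta>)) - \<theta> / \<delta>\<bar>"
    using assms by (simp add: abs_mult abs_minus_commute)
  also have "\<dots> \<le> \<delta> * (1 / 2)"
    using assms of_int_round_abs_le[of "\<theta> / \<delta>"] by (intro mult_left_mono) auto
  finally show ?thesis by simp
qed

text \<open>The gap of a whole step between the largest level and the bound is harmless because grid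
  points are a step apart; this is where the \<open>- \<delta>\<close> in the hypothesis on \<open>\<beta>\<close> is absorbed.\<close>

lemma grid_point_in_levels:
  assumes "\<delta> > 0" and "ereal \<bar>of_int k * \<delta>\<bar> < ereal_of_enat M * ereal \<delta> + ereal \<delta>"
  shows "of_int k * \<delta> \<in> levels \<delta> M"
proof -
  have "enat (nat \<bar>k\<bar>) \<le> M"
  proof (cases M)
    case (enat m)
    have "\<bar>of_int k\<bar> * \<delta> < (real m + 1) * \<delta>"
      using assms by (simp add: enat abs_mult algebra_simps)
    then have "\<bar>of_int k\<bar> < real m + 1" using assms(1) by simp
    then have "nat \<bar>k\<bar> \<le> m" by linarith
    then show ?thesis by (simp add: enat)
  qed simp
  then show ?thesis by (auto simp: levels_def)
qed

lemma midpoint_distance_to_levels: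
  assumes "\<delta> > 0" and "u \<in> levels \<delta> M"
  shows "\<delta> / 2 \<le> \<bar>(of_int j + 1 / 2) * \<delta> - u\<bar>"
proof -
  obtain k :: int where k: "u = of_int k * \<delta>" using assms(2) by (auto simp: levels_def)
  have "1 / 2 \<le> \<bar>of_int (j - k) + 1 / 2 :: real\<bar>"
  proof (cases "j - k \<ge> 0")
    case True
    then have "of_int (j - k) \<ge> (0 :: real)" by (simp only: of_int_0_le_iff)
    then show ?thesis by linarith
  next
    case False
    then have "j - k \<le> - 1" by simp
    then have "of_int (j - k) \<le> (of_int (- 1) :: real)" by (simp only: of_int_le_iff)
    then show ?thesis by simp
  qed
  then have "1 / 2 * \<delta> \<le> \<bar>of_int (j - k) + 1 / 2 :: real\<bar> * \<delta>"
    using assms(1) by (intro mult_right_mono) auto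
  also have "\<dots> = \<bar>(of_int j + 1 / 2) * \<delta> - u\<bar>"
  proof -
    have "(of_int j + 1 / 2) * \<delta> - u = (of_int (j - k) + 1 / 2) * \<delta>"
      by (simp add: k algebra_simps)
    then show ?thesis using assms(1) by (simp only: abs_mult abs_of_pos)
  qed
  finally show ?thesis by simp
qed

section \<open>The linear system and the inverse of its numerator\<close>

lemma lti_state_cong:
  "(\<And>i. i < n \<Longrightarrow> v i = w i) \<Longrightarrow> lti_state A B v n = lti_state A B w n"
  by (induction n) auto

lemma lti_output_Suc:
  assumes "C \<bullet> B \<noteq> 0"
  shows "lti_output A B C w (Suc n) =
    (C \<bullet> B) * (inverse (C \<bullet> B) * (C \<bullet> (A *v lti_state A B w n)) + w n)"
  using assms by (simp add: lti_output_def inner_add_right field_simps)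

lemma difference_equation:
  assumes "equivalent_difference_equation A B C k a b"
  shows "lti_output A B C w (Suc n) =
    (\<Sum>i\<le>k. a i * delayed (lti_output A B C w) n i) + (\<Sum>j\<le>k. b j * delayed w n j)"
  using assms unfolding equivalent_difference_equation_def by blast

text \<open>Comparing the two descriptions of the response to a unit impulse at time 0, evaluated at time 1.\<close>

lemma leading_coefficient:
  assumes "equivalent_difference_equation A B C k a b"
  shows "b 0 = C \<bullet> B"
proof -
  let ?w = "\<lambda>n. if n = 0 then 1 else 0 :: real"
  have "lti_output A B C ?w (Suc 0) = C \<bullet> B"
    by (simp add: lti_output_def)
  moreover have "(\<Sum>i\<le>k. a i * delayed (lti_output A B C ?w) 0 i) = 0"
    by (intro sum.neutral) (auto simp: delayed_def lti_output_def)
  moreover have "(\<Sum>j\<le>k. b j * delayed ?w 0 j) = (\<Sum>j\<le>k. if j = 0 then b j else 0)"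
    by (intro sum.cong) (auto simp: delayed_def)
  ultimately show ?thesis
    using difference_equation[OF assms, of ?w 0] by simp
qed

definition numerator_fps :: "nat \<Rightarrow> (nat \<Rightarrow> 'a::comm_ring_1) \<Rightarrow> 'a fps" where
  "numerator_fps k b = (\<Sum>j\<le>k. fps_const (b j) * fps_X ^ j)"

lemma numerator_fps_nth: "fps_nth (numerator_fps k b) n = (if n \<le> k then b n else 0)"
proof -
  have "fps_nth (numerator_fps k b) n = (\<Sum>j\<le>k. if j = n then b j else 0)"
    unfolding numerator_fps_def fps_sum_nth by (intro sum.cong) (auto simp: fps_X_power_nth)
  then show ?thesis by simp
qed

lemma inverse_numerator_fps:
  assumes b0: "b 0 \<noteq> 0"
    and c: "\<And>z. norm z > R \<Longrightarrow> (\<lambda>l. of_real (c l) / z ^ l) sums inverse_numerator k b z"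
  shows "Abs_fps c * numerator_fps k b = 1"
proof -
  define P where "P = numerator_fps k (\<lambda>j. complex_of_real (b j))"
  define Q where "Q = Abs_fps (\<lambda>l. complex_of_real (c l))"
  \<comment> \<open>For nonzero \<open>w\<close>, \<open>norm w < e\<close> forces \<open>norm (1 / w) > R\<close>, whatever the sign of \<open>R\<close>.\<close>
  define e where "e = 1 / (\<bar>R\<bar> + 1)"
  have e: "e > 0" by (simp add: e_def add_nonneg_pos)
  have sums: "(\<lambda>l. fps_nth Q l * w ^ l) sums inverse (\<Sum>j\<le>k. of_real (b j) * w ^ j)"
    if "w \<noteq> 0" "norm w < e" for w
  proof -
    have "R < norm (1 / w)"
    proof -
      have "(\<bar>R\<bar> + 1) * norm w < 1"
        using that(2) by (simp add: e_def field_simps)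
      then have "\<bar>R\<bar> + 1 < 1 / norm w" using that(1) by (simp add: field_simps)
      then show ?thesis by (simp add: norm_divide)
    qed
    from c[OF this] show ?thesis
      using that(1) by (simp add: Q_def inverse_numerator_def field_simps)
  qed
  have rad: "fps_conv_radius Q \<ge> ereal (e / 2)"
  proof -
    let ?w = "of_real (e / 2) :: complex"
    have "summable (\<lambda>l. fps_nth Q l * ?w ^ l)"
      by (rule sums_summable, rule sums) (use e in auto)
    then have "conv_radius (fps_nth Q) \<ge> ereal (norm ?w)" by (rule conv_radius_geI)
    then show ?thesis using e by (simp add: fps_conv_radius_def)
  qed
  have P_exp: "(\<lambda>w. \<Sum>j\<le>k. of_real (b j) * w ^ j) has_fps_expansion P"
    unfolding P_def numerator_fps_def by (intro fps_expansion_intros)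
  have "(\<lambda>w. inverse (\<Sum>j\<le>k. of_real (b j) * w ^ j)) has_fps_expansion inverse P"
    by (rule has_fps_expansion_inverse[OF P_exp]) (simp add: P_def numerator_fps_nth b0)
  then have L1: "(\<lambda>w. inverse (\<Sum>j\<le>k. of_real (b j) * w ^ j)) has_laurent_expansion
      fps_to_fls (inverse P)"
    by (rule has_laurent_expansion_fps)
  \<comment> \<open>The series is known only for nonzero \<open>w = 1 / z\<close>; Laurent expansions at 0 do not see the
    value there, and so identify the coefficients without a separate limit argument.\<close>
  have "eventually (\<lambda>w. eval_fls (fps_to_fls Q) w = inverse (\<Sum>j\<le>k. of_real (b j) * w ^ j)) (at 0)"
    unfolding eventually_at
  proof (intro exI[of _ "e / 2"] conjI ballI impI)
    fix w :: complex assume w: "w \<noteq> 0 \<and> dist w 0 < e / 2"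
    then have "ereal (norm w) < ereal (e / 2)" by simp
    then have "ereal (norm w) < fps_conv_radius Q" using rad by (rule less_le_trans)
    then have "eval_fls (fps_to_fls Q) w = (\<Sum>l. fps_nth Q l * w ^ l)"
      by (simp add: eval_fps_to_fls eval_fps_def)
    also have "\<dots> = inverse (\<Sum>j\<le>k. of_real (b j) * w ^ j)"
      using w e by (intro sums_unique[symmetric] sums) auto
    finally show "eval_fls (fps_to_fls Q) w = inverse (\<Sum>j\<le>k. of_real (b j) * w ^ j)" .
  qed (use e in simp)
  then have L2: "(\<lambda>w. inverse (\<Sum>j\<le>k. of_real (b j) * w ^ j)) has_laurent_expansion fps_to_fls Q"
    using e less_le_trans[OF _ rad, of 0] by (simp add: has_laurent_expansion_def)
  have "Q = inverse P"
    using has_laurent_expansion_unique[OF L2 L1] by simp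
  then have QP: "Q * P = 1"
    by (simp add: inverse_mult_eq_1 P_def numerator_fps_nth b0)
  show ?thesis
  proof (rule fps_ext)
    fix n
    have "complex_of_real (fps_nth (Abs_fps c * numerator_fps k b) n) = fps_nth (Q * P) n"
      unfolding fps_mult_nth of_real_sum
      by (intro sum.cong) (auto simp: Q_def P_def numerator_fps_nth)
    then have "complex_of_real (fps_nth (Abs_fps c * numerator_fps k b) n)
        = complex_of_real (fps_nth 1 n)" by (simp add: QP)
    then show "fps_nth (Abs_fps c * numerator_fps k b) n = fps_nth 1 n"
      by (simp only: of_real_eq_iff)
  qed
qed

lemma deconvolution:
  fixes b c u :: "nat \<Rightarrow> real"
  assumes "Abs_fps c * numerator_fps k b = 1"
  shows "u n = (\<Sum>l\<le>n. c l * (\<Sum>j\<le>k. b j * delayed u (n - l) j))"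
proof -
  have conv: "fps_nth (numerator_fps k b * Abs_fps u) m = (\<Sum>j\<le>k. b j * delayed u m j)" for m
  proof -
    have "fps_nth (numerator_fps k b * Abs_fps u) m
        = (\<Sum>j\<in>{0..m}. if j \<le> k then b j * u (m - j) else 0)"
      unfolding fps_mult_nth by (intro sum.cong) (auto simp: numerator_fps_nth)
    also have "\<dots> = (\<Sum>j\<in>{0..m} \<inter> {..k}. b j * u (m - j))"
      by (subst sum.inter_restrict) auto
    also have "\<dots> = (\<Sum>j\<le>k. b j * delayed u m j)"
      by (rule sum.mono_neutral_cong_left) (auto simp: delayed_def)
    finally show ?thesis .
  qed
  have "Abs_fps u = Abs_fps c * (numerator_fps k b * Abs_fps u)"
    using assms by (simp flip: mult.assoc)
  then have "u n = fps_nth (Abs_fps c * (numerator_fps k b * Abs_fps u)) n"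
    by (metis fps_nth_Abs_fps)
  also have "\<dots> = (\<Sum>l\<le>n. c l * fps_nth (numerator_fps k b * Abs_fps u) (n - l))"
    by (simp only: fps_mult_nth[of "Abs_fps c"] fps_nth_Abs_fps atLeast0AtMost)
  finally show ?thesis by (simp only: conv)
qed

lemma abs_sum_delayed_le:
  assumes "\<And>i. i \<le> n \<Longrightarrow> \<bar>s i\<bar> \<le> h" and "h \<ge> 0"
  shows "\<bar>\<Sum>i\<le>k. a i * delayed s n i\<bar> \<le> (\<Sum>i\<le>k. \<bar>a i\<bar>) * h"
proof -
  have "\<bar>\<Sum>i\<le>k. a i * delayed s n i\<bar> \<le> (\<Sum>i\<le>k. \<bar>a i * delayed s n i\<bar>)"
    by (rule sum_abs)
  also have "\<dots> \<le> (\<Sum>i\<le>k. \<bar>a i\<bar> * h)"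
    using assms by (intro sum_mono) (auto simp: abs_mult delayed_def intro!: mult_left_mono)
  finally show ?thesis by (simp add: sum_distrib_right)
qed

text \<open>The control effort needed to keep the output small is bounded: the difference equation
  expresses the convolution of \<open>u\<close> with the numerator coefficients through \<open>r\<close> and the
  output, all of which are bounded, and convolution with the unit sample response \<open>c\<close> of the
  inverse numerator recovers \<open>u\<close> at the cost of a factor \<open>\<Sum>\<bar>c l\<bar>\<close>.\<close>

lemma control_bound:
  assumes ab: "equivalent_difference_equation A B C k a b"
    and inv: "Abs_fps c * numerator_fps k b = 1"
    and w: "\<And>i. i \<le> n \<Longrightarrow> w i = r i - u i"
    and r: "\<And>i. i \<le> n \<Longrightarrow> \<bar>r i\<bar> \<le> 1"
    and q: "\<And>i. i \<le> Suc n \<Longrightarrow> \<bar>lti_output A B C w i\<bar> \<le> h"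
  shows "\<bar>u n\<bar> \<le> (h * ((\<Sum>i\<le>k. \<bar>a i\<bar>) + 1) + (\<Sum>j\<le>k. \<bar>b j\<bar>)) * (\<Sum>l\<le>n. \<bar>c l\<bar>)"
    (is "_ \<le> ?g * _")
proof -
  have h: "h \<ge> 0" using q[of 0] by simp
  have step: "\<bar>\<Sum>j\<le>k. b j * delayed u m j\<bar> \<le> ?g" if m: "m \<le> n" for m
  proof -
    have "(\<Sum>j\<le>k. b j * delayed w m j)
        = (\<Sum>j\<le>k. b j * delayed r m j) - (\<Sum>j\<le>k. b j * delayed u m j)"
      unfolding sum_subtractf[symmetric] using m
      by (intro sum.cong) (auto simp: delayed_def w algebra_simps)
    moreover have "lti_output A B C w (Suc m) =
        (\<Sum>i\<le>k. a i * delayed (lti_output A B C w) m i) + (\<Sum>j\<le>k. b j * delayed w m j)"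
      using ab by (rule difference_equation)
    moreover have "\<bar>lti_output A B C w (Suc m)\<bar> \<le> h" using m by (intro q) simp
    moreover have "\<bar>\<Sum>i\<le>k. a i * delayed (lti_output A B C w) m i\<bar> \<le> (\<Sum>i\<le>k. \<bar>a i\<bar>) * h"
      using m h by (intro abs_sum_delayed_le q) auto
    moreover have "\<bar>\<Sum>j\<le>k. b j * delayed r m j\<bar> \<le> (\<Sum>j\<le>k. \<bar>b j\<bar>) * 1"
      using m by (intro abs_sum_delayed_le r) auto
    moreover have "h * ((\<Sum>i\<le>k. \<bar>a i\<bar>) + 1) = (\<Sum>i\<le>k. \<bar>a i\<bar>) * h + h"
      by (simp add: algebra_simps)
    ultimately show ?thesis by linarith
  qed
  have "\<bar>u n\<bar> \<le> (\<Sum>l\<le>n. \<bar>c l * (\<Sum>j\<le>k. b j * delayed u (n - l) j)\<bar>)"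
    by (subst deconvolution[OF inv, of u n]) (rule sum_abs)
  also have "\<dots> \<le> (\<Sum>l\<le>n. \<bar>c l\<bar> * ?g)"
    unfolding abs_mult by (intro sum_mono mult_left_mono step) auto
  also have "\<dots> = ?g * (\<Sum>l\<le>n. \<bar>c l\<bar>)"
    by (subst sum_distrib_right[symmetric]) (rule mult.commute)
  finally show ?thesis .
qed

section \<open>The output of the greedy converter never overloads\<close>

lemma opt_state_eq_lti_state:
  "opt_state A B C \<delta> M r n = lti_state A B (\<lambda>n. r n - opt_adc A B C \<delta> M r n) n"
  by (induction n) (auto simp: opt_adc_def algebra_simps)

text \<open>Replace the last quantization by rounding to the unbounded grid \<open>\<delta>\<int>\<close>. The output then
  stays within \<open>\<bar>C \<bullet> B\<bar> \<delta> / 2\<close> also at the next instant, so the control bound applies to the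
  rounded value and shows that it is below \<open>(M + 1) \<delta>\<close>. Being a grid point, it is one of the
  available levels, and the actual quantizer does at least as well.\<close>

lemma opt_output_bound:
  assumes CB: "C \<bullet> B \<noteq> 0"
    and \<delta>: "\<delta> > 0"
    and ab: "equivalent_difference_equation A B C k a b"
    and inv: "Abs_fps c * numerator_fps k b = 1"
    and M\<beta>: "ereal_of_enat M * ereal \<delta> > overload_bound B C \<delta> k a b c - ereal \<delta>"
    and r: "\<And>i. \<bar>r i\<bar> \<le> 1"
  shows "\<bar>lti_output A B C (\<lambda>n. r n - opt_adc A B C \<delta> M r n) n\<bar> \<le> \<bar>C \<bullet> B\<bar> * \<delta> / 2"
proof (induction n rule: less_induct)
  case (less n)
  let ?u = "opt_adc A B C \<delta> M r"
  let ?w = "\<lambda>n. r n - ?u n"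
  let ?h = "\<bar>C \<bullet> B\<bar> * \<delta> / 2"
  show ?case
  proof (cases n)
    case 0
    then show ?thesis using \<delta> by (simp add: lti_output_def)
  next
    case (Suc m)
    define \<theta> where "\<theta> = inverse (C \<bullet> B) * (C \<bullet> (A *v lti_state A B ?w m)) + r m"
    define j where "j = round (\<theta> / \<delta>)"
    define u' where "u' = ?u(m := of_int j * \<delta>)"
    let ?w' = "\<lambda>n. r n - u' n"
    have j: "\<bar>\<theta> - of_int j * \<delta>\<bar> \<le> \<delta> / 2"
      unfolding j_def using \<delta> by (rule round_to_grid)
    have same: "lti_state A B ?w' i = lti_state A B ?w i" if "i \<le> m" for i
      using that by (intro lti_state_cong) (auto simp: u'_def)
    have out': "\<bar>lti_output A B C ?w' i\<bar> \<le> ?h" if i: "i \<le> Suc m" for i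
    proof (cases "i \<le> m")
      case True
      then show ?thesis using less.IH[of i] Suc same[OF True] by (simp add: lti_output_def)
    next
      case False
      then have "i = Suc m" using i by simp
      moreover have "lti_output A B C ?w' (Suc m) = (C \<bullet> B) * (\<theta> - of_int j * \<delta>)"
        using same[of m] by (simp only: lti_output_Suc[OF CB]) (simp add: \<theta>_def u'_def)
      moreover have "\<bar>C \<bullet> B\<bar> * \<bar>\<theta> - of_int j * \<delta>\<bar> \<le> \<bar>C \<bullet> B\<bar> * (\<delta> / 2)"
        using j by (intro mult_left_mono) auto
      ultimately show ?thesis by (simp add: abs_mult)
    qed
    define g where "g = \<bar>C \<bullet> B\<bar> * (\<delta> / 2) * ((\<Sum>i\<le>k. \<bar>a i\<bar>) + 1) + (\<Sum>j\<le>k. \<bar>b j\<bar>)"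
    have "g \<ge> 0" unfolding g_def using \<delta> by (intro add_nonneg_nonneg mult_nonneg_nonneg sum_nonneg) auto
    have "\<bar>u' m\<bar> \<le> g * (\<Sum>l\<le>m. \<bar>c l\<bar>)"
      using control_bound[OF ab inv _ _ out', where r = r and u = u'] r by (simp add: g_def)
    then have "ereal \<bar>of_int j * \<delta>\<bar> \<le> ereal g * ereal (\<Sum>l\<le>m. \<bar>c l\<bar>)"
      by (simp add: u'_def)
    also have "ereal (\<Sum>l\<le>m. \<bar>c l\<bar>) = (\<Sum>l<Suc m. ereal \<bar>c l\<bar>)"
      by (simp add: lessThan_Suc_atMost)
    also have "ereal g * \<dots> \<le> ereal g * (\<Sum>l. ereal \<bar>c l\<bar>)"
      using \<open>g \<ge> 0\<close> by (intro ereal_mult_left_mono suminf_upper) auto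
    also have "\<dots> = overload_bound B C \<delta> k a b c"
      by (simp add: overload_bound_def g_def)
    also have "\<dots> < ereal_of_enat M * ereal \<delta> + ereal \<delta>"
      using M\<beta> by (simp add: ereal_minus_less)
    finally have "of_int j * \<delta> \<in> levels \<delta> M"
      by (rule grid_point_in_levels[OF \<delta>])
    then have "\<bar>\<theta> - quantizer \<delta> M \<theta>\<bar> \<le> \<bar>\<theta> - of_int j * \<delta>\<bar>"
      by (rule quantizer_nearest[OF \<delta>])
    then have "\<bar>C \<bullet> B\<bar> * \<bar>\<theta> - quantizer \<delta> M \<theta>\<bar> \<le> \<bar>C \<bullet> B\<bar> * (\<delta> / 2)"
      using j by (intro mult_left_mono) auto
    moreover have "?u m = quantizer \<delta> M \<theta>"
      by (simp only: opt_adc_def[of _ _ _ _ _ _ m] opt_control_def opt_state_eq_lti_state \<theta>_def)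
    then have "lti_output A B C ?w n = (C \<bullet> B) * (\<theta> - quantizer \<delta> M \<theta>)"
      by (simp only: Suc lti_output_Suc[OF CB]) (simp add: \<theta>_def)
    ultimately show ?thesis by (simp add: abs_mult)
  qed
qed

lemma opt_state_cong:
  "(\<And>i. i < n \<Longrightarrow> r i = s i) \<Longrightarrow> opt_state A B C \<delta> M r n = opt_state A B C \<delta> M s n"
  by (induction n) auto

text \<open>The argument of \<open>\<Upsilon> n\<close> lists the input from the newest sample to the oldest; reversed and
  read by index, it is a signal that agrees with the input up to time \<open>n\<close>, which is all the
  recursion looks at.\<close>

lemma opt_adc_in_adc_class:
  assumes "\<delta> > 0"
  shows "opt_adc A B C \<delta> M \<in> adc_class (levels \<delta> M)"
proof -
  let ?Y = "\<lambda>n v. opt_adc A B C \<delta> M (\<lambda>i. rev v ! i) n"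
  have "?Y n v \<in> levels \<delta> M" for n v
    using assms by (simp add: opt_adc_def opt_control_def quantizer_in_levels)
  moreover have "opt_adc A B C \<delta> M r n = ?Y n (map r (rev [0..<n + 1]))" for r :: "nat \<Rightarrow> real" and n
  proof -
    have hist: "rev (map r (rev [0..<n + 1])) ! i = r i" if "i \<le> n" for i
      using that by (simp add: rev_map nth_append del: upt_Suc)
    have "opt_state A B C \<delta> M r n = opt_state A B C \<delta> M ((!) (rev (map r (rev [0..<n + 1])))) n"
      by (rule opt_state_cong) (simp only: hist less_imp_le)
    then show ?thesis
      by (simp only: opt_adc_def hist[OF order_refl])
  qed
  ultimately show ?thesis
    unfolding adc_class_def by (intro CollectI exI[of _ ?Y]) blast
qed

section \<open>The adversarial input\<close>

text \<open>Before step \<open>n\<close> the past of the input fixes the state and hence the free part of the next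
  output. As the input may be moved by 2, at least one grid step, it can place the value to
  be quantized exactly halfway between two grid points, where every level is at distance at
  least \<open>\<delta> / 2\<close>.\<close>

lemma adversarial_input:
  assumes CB: "C \<bullet> B \<noteq> 0"
    and \<delta>: "\<delta> \<in> {0<..2}"
    and \<Psi>: "\<Psi> \<in> adc_class (levels \<delta> M)"
  obtains r where "r \<in> ell_plus {-1..1}"
    and "\<And>n. \<bar>C \<bullet> B\<bar> * \<delta> / 2 \<le> \<bar>lti_output A B C (\<lambda>n. r n - \<Psi> r n) (Suc n)\<bar>"
proof -
  obtain Y where Y: "\<And>n v. length v = n + 1 \<Longrightarrow> set v \<subseteq> {-1..1} \<Longrightarrow> Y n v \<in> levels \<delta> M"
    and \<Psi>_eq: "\<And>r n. r \<in> ell_plus {-1..1} \<Longrightarrow> \<Psi> r n = Y n (map r (rev [0..<n + 1]))"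
    using \<Psi> unfolding adc_class_def by blast
  define X where "X r n = lti_state A B (\<lambda>i. r i - Y i (map r (rev [0..<i + 1]))) n" for r n
  \<comment> \<open>\<open>P r n \<rho>\<close>: after the past \<open>r 0, \<dots>, r (n - 1)\<close>, the sample \<open>\<rho>\<close> hits a midpoint. It depends on
    the past of \<open>r\<close> only, so choices along the well-founded order on time assemble into \<open>r\<close>.\<close>
  define P where "P r n \<rho> \<longleftrightarrow> \<rho> \<in> {-1..1} \<and>
    (\<exists>j::int. inverse (C \<bullet> B) * (C \<bullet> (A *v X r n)) + \<rho> = (of_int j + 1 / 2) * \<delta>)" for r n \<rho>
  have "\<exists>r. \<forall>n. P r n (r n)"
  proof (rule dependent_wf_choice[OF wf_less])
    fix r s :: "nat \<Rightarrow> real" and n \<rho>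
    assume eq: "\<And>i. (i, n) \<in> {(i, j). i < j} \<Longrightarrow> r i = s i"
    have "X r n = X s n"
      unfolding X_def
    proof (rule lti_state_cong)
      fix i assume i: "i < n"
      then have "map r (rev [0..<i + 1]) = map s (rev [0..<i + 1])"
        by (intro map_cong) (auto intro!: eq)
      moreover have "r i = s i" using i by (intro eq) simp
      ultimately show "r i - Y i (map r (rev [0..<i + 1])) = s i - Y i (map s (rev [0..<i + 1]))"
        by (simp only:)
    qed
    then show "P r n \<rho> = P s n \<rho>" by (simp only: P_def)
  next
    fix r :: "nat \<Rightarrow> real" and n
    define \<theta> where "\<theta> = inverse (C \<bullet> B) * (C \<bullet> (A *v X r n))"
    \<comment> \<open>the largest midpoint that does not exceed \<open>\<theta> + 1\<close>\<close>
    define j where "j = \<lfloor>(\<theta> + 1) / \<delta> - 1 / 2\<rfloor>"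
    have "of_int j \<le> (\<theta> + 1) / \<delta> - 1 / 2" "(\<theta> + 1) / \<delta> - 1 / 2 < of_int j + 1"
      unfolding j_def by linarith+
    then have "(of_int j + 1 / 2) * \<delta> \<le> \<theta> + 1" "\<theta> + 1 < (of_int j + 1 / 2) * \<delta> + \<delta>"
      using \<delta> by (simp_all add: field_simps)
    then have "P r n ((of_int j + 1 / 2) * \<delta> - \<theta>)"
      using \<delta> by (auto simp: P_def \<theta>_def)
    then show "\<exists>\<rho>. P r n \<rho>" ..
  qed
  then obtain r where r: "\<And>n. P r n (r n)" by blast
  have r_ell: "r \<in> ell_plus {-1..1}"
    using r unfolding ell_plus_def P_def by blast
  moreover have "\<bar>C \<bullet> B\<bar> * \<delta> / 2 \<le> \<bar>lti_output A B C (\<lambda>n. r n - \<Psi> r n) (Suc n)\<bar>" for n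
  proof -
    have X: "lti_state A B (\<lambda>n. r n - \<Psi> r n) n = X r n"
      by (simp only: X_def \<Psi>_eq[OF r_ell])
    obtain j :: int where j: "inverse (C \<bullet> B) * (C \<bullet> (A *v X r n)) + r n = (of_int j + 1 / 2) * \<delta>"
      using r[of n] by (auto simp: P_def)
    have "set (map r (rev [0..<n + 1])) \<subseteq> {-1..1}"
      using r_ell by (auto simp: ell_plus_def image_subset_iff)
    then have "\<Psi> r n \<in> levels \<delta> M"
      unfolding \<Psi>_eq[OF r_ell] by (intro Y) simp_all
    then have "\<delta> / 2 \<le> \<bar>(of_int j + 1 / 2) * \<delta> - \<Psi> r n\<bar>"
      using \<delta> by (intro midpoint_distance_to_levels) auto
    then have "\<bar>C \<bullet> B\<bar> * (\<delta> / 2) \<le> \<bar>C \<bullet> B\<bar> * \<bar>(of_int j + 1 / 2) * \<delta> - \<Psi> r n\<bar>"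
      by (rule mult_left_mono) simp
    also have "\<dots> = \<bar>lti_output A B C (\<lambda>n. r n - \<Psi> r n) (Suc n)\<bar>"
      using j by (simp only: lti_output_Suc[OF CB] X abs_mult[symmetric]) (simp add: algebra_simps)
    finally show ?thesis by simp
  qed
  ultimately show ?thesis by (rule that)
qed

section \<open>Average intensity\<close>

lemma awai_le:
  assumes "\<And>n. \<phi> (lti_output A B C w n) \<le> L" and "L \<ge> 0"
  shows "awai A B C \<phi> w \<le> ereal L"
  unfolding awai_def
proof (rule Limsup_bounded, rule always_eventually, rule allI)
  fix N
  have "(\<Sum>n<N. \<phi> (lti_output A B C w n)) \<le> real N * L"
    using sum_bounded_above[of "{..<N}" "\<lambda>n. \<phi> (lti_output A B C w n)" L] assms(1) by simp
  then show "ereal (1 / real N * (\<Sum>n<N. \<phi> (lti_output A B C w n))) \<le> ereal L"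
    using assms(2) by (cases "N = 0") (simp_all add: field_simps)
qed

text \<open>The output is always 0 at time 0, so the lower bound \<open>L\<close> holds only from time 1 on;
  the averages are then at least \<open>L - L / N\<close>, which has the same limit.\<close>

lemma awai_ge:
  assumes "\<And>n. L \<le> \<phi> (lti_output A B C w (Suc n))" and "\<phi> 0 \<ge> 0"
  shows "ereal L \<le> awai A B C \<phi> w"
proof -
  have "(\<lambda>N. L - L / real N) \<longlonglongrightarrow> L - 0"
    by (intro tendsto_intros lim_const_over_n)
  then have "(\<lambda>N. ereal (L - L / real N)) \<longlonglongrightarrow> ereal L" by simp
  then have "ereal L = limsup (\<lambda>N. ereal (L - L / real N))"
    by (intro lim_imp_Limsup[symmetric]) simp_all
  also have "\<dots> \<le> limsup (\<lambda>N. ereal (1 / real N * (\<Sum>n<N. \<phi> (lti_output A B C w n))))"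
  proof (rule Limsup_mono, rule eventually_sequentiallyI[of 1])
    fix N :: nat assume "1 \<le> N"
    then obtain m where N: "N = Suc m" by (cases N) auto
    have "real m * L \<le> (\<Sum>n<m. \<phi> (lti_output A B C w (Suc n)))"
      using sum_bounded_below[of "{..<m}" L "\<lambda>n. \<phi> (lti_output A B C w (Suc n))"] assms(1)
      by simp
    also have "\<dots> \<le> (\<Sum>n<N. \<phi> (lti_output A B C w n))"
      unfolding N sum.lessThan_Suc_shift using assms(2) by (simp add: lti_output_def)
    finally have "real N * L - L \<le> (\<Sum>n<N. \<phi> (lti_output A B C w n))"
      by (simp add: N algebra_simps)
    then have "(real N * L - L) / real N \<le> (\<Sum>n<N. \<phi> (lti_output A B C w n)) / real N"
      by (rule divide_right_mono) simp
    then show "ereal (L - L / real N) \<le> ereal (1 / real N * (\<Sum>n<N. \<phi> (lti_output A B C w n)))"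
      using \<open>1 \<le> N\<close> by (simp add: diff_divide_distrib)
  qed
  finally show ?thesis by (simp add: awai_def)
qed

theorem theorem1:
  fixes A :: "real^'m^'m" and B C :: "real^'m"
    and \<delta> :: real and M :: enat
    and k :: nat and a b c :: "nat \<Rightarrow> real"
    and f \<phi> :: "real \<Rightarrow> real"
  assumes CB: "C \<bullet> B \<noteq> 0"
    and \<delta>: "\<delta> \<in> {0<..2}"
    and ab: "equivalent_difference_equation A B C k a b"
    and c: "\<And>z. norm z > max_pole_modulus (inverse_numerator k b) \<Longrightarrow>
              (\<lambda>l. of_real (c l) / z ^ l) sums inverse_numerator k b z"
    and M1: "ereal_of_enat M * ereal \<delta> > 1"
    and M\<beta>: "ereal_of_enat M * ereal \<delta> > overload_bound B C \<delta> k a b c - ereal \<delta>"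
    and f_nonneg: "\<And>x. x \<ge> 0 \<Longrightarrow> f x \<ge> 0"
    and f_mono: "mono_on {0..} f"
    and \<phi>: "\<And>q. \<phi> q = f \<bar>q\<bar>"
  shows "opt_adc A B C \<delta> M \<in> adc_class (levels \<delta> M) \<and>
    (\<forall>\<Psi>\<in>adc_class (levels \<delta> M).
       adc_performance A B C \<phi> \<Psi> \<ge> adc_performance A B C \<phi> (opt_adc A B C \<delta> M)) \<and>
    adc_performance A B C \<phi> (opt_adc A B C \<delta> M) = ereal (\<phi> (\<bar>C \<bullet> B\<bar> * \<delta> / 2))"
proof (intro conjI ballI)
  let ?L = "\<phi> (\<bar>C \<bullet> B\<bar> * \<delta> / 2)"
  let ?opt = "opt_adc A B C \<delta> M"
  have \<delta>0: "\<delta> > 0" using \<delta> by simp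
  have \<phi>_mono: "\<phi> p \<le> \<phi> q" if "\<bar>p\<bar> \<le> \<bar>q\<bar>" for p q
    unfolding \<phi> using that by (intro mono_onD[OF f_mono]) auto
  have \<phi>_nonneg: "\<phi> q \<ge> 0" for q by (simp add: \<phi> f_nonneg)
  have abs_half_step: "\<bar>\<bar>C \<bullet> B\<bar> * \<delta> / 2\<bar> = \<bar>C \<bullet> B\<bar> * \<delta> / 2"
    using \<delta>0 by simp
  have b0: "b 0 \<noteq> 0" using leading_coefficient[OF ab] CB by simp
  have inv: "Abs_fps c * numerator_fps k b = 1"
    using b0 c by (rule inverse_numerator_fps)
  show mem: "?opt \<in> adc_class (levels \<delta> M)"
    using \<delta>0 by (rule opt_adc_in_adc_class)
  have upper: "adc_performance A B C \<phi> ?opt \<le> ereal ?L"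
    unfolding adc_performance_def
  proof (intro SUP_least awai_le \<phi>_nonneg \<phi>_mono)
    fix r :: "nat \<Rightarrow> real" and n assume "r \<in> ell_plus {-1..1}"
    then have "\<bar>r i\<bar> \<le> 1" for i by (auto simp: ell_plus_def abs_le_iff image_subset_iff minus_le_iff)
    then show "\<bar>lti_output A B C (\<lambda>n. r n - ?opt r n) n\<bar> \<le> \<bar>\<bar>C \<bullet> B\<bar> * \<delta> / 2\<bar>"
      unfolding abs_half_step by (rule opt_output_bound[OF CB \<delta>0 ab inv M\<beta>])
  qed
  have lower: "ereal ?L \<le> adc_performance A B C \<phi> \<Psi>" if \<Psi>: "\<Psi> \<in> adc_class (levels \<delta> M)" for \<Psi>
  proof -
    obtain r where r: "r \<in> ell_plus {-1..1}"
      and out: "\<And>n. \<bar>C \<bullet> B\<bar> * \<delta> / 2 \<le> \<bar>lti_output A B C (\<lambda>n. r n - \<Psi> r n) (Suc n)\<bar>"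
      using adversarial_input[OF CB \<delta> \<Psi>, where A = A] by blast
    have "ereal ?L \<le> awai A B C \<phi> (\<lambda>n. r n - \<Psi> r n)"
      by (intro awai_ge \<phi>_mono \<phi>_nonneg) (simp only: abs_half_step out)
    also have "\<dots> \<le> adc_performance A B C \<phi> \<Psi>"
      unfolding adc_performance_def using r by (rule SUP_upper)
    finally show ?thesis .
  qed
  show "adc_performance A B C \<phi> ?opt \<le> adc_performance A B C \<phi> \<Psi>"
    if "\<Psi> \<in> adc_class (levels \<delta> M)" for \<Psi>
    using upper lower[OF that] by (rule order_trans)
  show "adc_performance A B C \<phi> ?opt = ereal ?L"
    using upper lower[OF mem] by (rule antisym)
qed

end
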